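(* Let $\alpha\in(0,1]$, $\ell\ge0$, $\beta>0$ a constant, and $z_0\in\mathbb{R}^d$. Suppose that $f:\mathbb{R}^d\to\mathbb{R}$ is of class $C^1$ and convex, with $S(f)=\{x\in\mathbb{R}^d:\nabla f(x)=0\}\ne\emptyset$, and let $f_*=\min_{x\in\mathbb{R}^d}f(x)$. Suppose that $\psi:[\ell,\infty)\to[0,\infty)$ is strictly increasing, of class $C^1$, with $\psi'>0$ and $\sup_{t\ge\ell}\psi(t)=\infty$. Let $z$ be a solution of $${}^{C}D_{\ell,\psi}^{\alpha}z(t)=-\beta\nabla f(z(t))\quad(t\ge\ell),\qquad z(\ell)=z_0 .$$ Then $z$ is bounded, and there is a sequence $\{s_m\}\subseteq[\ell,\infty)$ such that $\{z(s_m)\}$ converges to a point in $S(f)$. Furthermore, setting $$\widehat{z}(t)=\frac{\Gamma(\alpha+1)}{(\psi(t)-\psi(\ell))^{\alpha}}\,(I_{\ell,\psi}^{\alpha}z)(t)\quad(t>\ell),$$ $f(\widehat z(t))$ converges to $f_*$ with $f(\widehat z(t))-f_*=O(\psi(t)^{-\alpha})$ as $t\to\infty$.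
   Context: For $0<\gamma\le 1$, the $\psi$-Riemann-Liouville integral is $(I_{\ell,\psi}^{\gamma}x)(t)=\frac{1}{\Gamma(\gamma)}\int_\ell^t(\psi(t)-\psi(\tau))^{\gamma-1}\psi'(\tau)x(\tau)\,d\tau$, and $I_{\ell,\psi}^{0}$ is the identity. For $0<\alpha\le1$ the $\psi$-Caputo fractional derivative is ${}^{C}D_{\ell,\psi}^{\alpha}=I_{\ell,\psi}^{1-\alpha}\circ J_\psi$, where $J_\psi=\frac{1}{\psi'(t)}\frac{d}{dt}$. For vector-valued functions these are applied componentwise. A solution is a continuous function satisfying the equation for every $t\ge\ell$ together with the initial condition. *)

theory Defs
  imports "HOL-Analysis.Analysis" "HOL-Library.Landau_Symbols"
begin

text \<open>The derivative of a function on \<open>[\<ell>,\<infinity>)\<close>: one-sided at \<open>\<ell>\<close>, two-sided elsewhere. It is used both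
  for \<open>\<psi>\<close> and for trajectories.\<close>

definition hderiv :: "real \<Rightarrow> (real \<Rightarrow> 'a::real_normed_vector) \<Rightarrow> real \<Rightarrow> 'a" where
  "hderiv l x t = vector_derivative x (at t within {l..})"

definition C1_halfline :: "real \<Rightarrow> (real \<Rightarrow> 'a::real_normed_vector) \<Rightarrow> bool" where
  "C1_halfline l x \<longleftrightarrow>
     (\<forall>t\<ge>l. x differentiable (at t within {l..})) \<and> continuous_on {l..} (hderiv l x)"

text \<open>The integrand of the \<open>\<psi>\<close>-Riemann-Liouville integral of order \<open>\<gamma>\<close>. The value \<open>0 powr _ = 0\<close> at
  \<open>\<tau> = t\<close> affects a single point only.\<close>

definition psi_RL_integrand ::
  "real \<Rightarrow> (real \<Rightarrow> real) \<Rightarrow> real \<Rightarrow> (real \<Rightarrow> 'a::euclidean_space) \<Rightarrow> real \<Rightarrow> real \<Rightarrow> 'a" where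
  "psi_RL_integrand l \<psi> \<gamma> x t \<tau> =
     ((\<psi> t - \<psi> \<tau>) powr (\<gamma> - 1) * hderiv l \<psi> \<tau>) *\<^sub>R x \<tau>"

definition psi_RL_integral ::
  "real \<Rightarrow> (real \<Rightarrow> real) \<Rightarrow> real \<Rightarrow> (real \<Rightarrow> 'a::euclidean_space) \<Rightarrow> real \<Rightarrow> 'a" where
  "psi_RL_integral l \<psi> \<gamma> x t =
     (if \<gamma> = 0 then x t
      else (1 / Gamma \<gamma>) *\<^sub>R integral {l..t} (psi_RL_integrand l \<psi> \<gamma> x t))"

definition J_psi ::
  "real \<Rightarrow> (real \<Rightarrow> real) \<Rightarrow> (real \<Rightarrow> 'a::real_normed_vector) \<Rightarrow> real \<Rightarrow> 'a" where
  "J_psi l \<psi> x t = (1 / hderiv l \<psi> t) *\<^sub>R hderiv l x t"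

definition psi_caputo ::
  "real \<Rightarrow> (real \<Rightarrow> real) \<Rightarrow> real \<Rightarrow> (real \<Rightarrow> 'a::euclidean_space) \<Rightarrow> real \<Rightarrow> 'a" where
  "psi_caputo l \<psi> \<alpha> x = psi_RL_integral l \<psi> (1 - \<alpha>) (J_psi l \<psi> x)"

text \<open>Both \<open>vector_derivative\<close> and \<open>integral\<close> are total, so that an equation for \<open>psi_caputo\<close> is
  meaningful only together with the existence of the objects involved.\<close>

definition psi_caputo_exists ::
  "real \<Rightarrow> (real \<Rightarrow> real) \<Rightarrow> real \<Rightarrow> (real \<Rightarrow> 'a::euclidean_space) \<Rightarrow> real \<Rightarrow> bool" where
  "psi_caputo_exists l \<psi> \<alpha> x t \<longleftrightarrow>
     (if \<alpha> = 1 then x differentiable (at t within {l..})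
      else psi_RL_integrand l \<psi> (1 - \<alpha>) (J_psi l \<psi> x) t integrable_on {l..t})"

text \<open>Local absolute continuity on \<open>[\<ell>,\<infinity>)\<close>: the derivative exists almost everywhere, is locally Lebesgue
  integrable, and \<open>x\<close> is its primitive. This is the widest usual class on which the composition
  \<open>I\<^sup>1\<^sup>-\<^sup>\<alpha> \<circ> J\<^sub>\<psi>\<close> is used. It contains every continuous function on \<open>[\<ell>,\<infinity>)\<close> that is differentiable on
  \<open>(\<ell>,\<infinity>)\<close> and whose Caputo integrand is Lebesgue integrable on each \<open>[\<ell>,t]\<close>. Without it the
  a.e. derivative does not determine \<open>x\<close> (Cantor function).\<close>

definition locally_AC :: "real \<Rightarrow> (real \<Rightarrow> 'a::euclidean_space) \<Rightarrow> bool" where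
  "locally_AC l x \<longleftrightarrow>
     negligible {t. l \<le> t \<and> \<not> x differentiable (at t within {l..})} \<and>
     (\<forall>t\<ge>l. hderiv l x absolutely_integrable_on {l..t} \<and>
            x t = x l + integral {l..t} (hderiv l x))"

text \<open>Solutions of \<open>\<^sup>CD\<^sup>\<alpha> z(t) = F(z(t))\<close>, \<open>z(\<ell>) = z\<^sub>0\<close>. The equation is imposed for \<open>t > \<ell>\<close>. For \<open>\<alpha> < 1\<close>
  the fractional integral at \<open>t = \<ell>\<close> is an integral over a point, hence \<open>0\<close>, and the literal equation
  there would force \<open>F z\<^sub>0 = 0\<close>; understood as a limit \<open>t \<rightarrow> \<ell>+\<close> it follows, for continuous \<open>F\<close>, from the
  equation for \<open>t > \<ell>\<close>. For \<open>\<alpha> = 1\<close> and continuous \<open>F\<close> the equation with the one-sided derivative at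
  \<open>\<ell>\<close> follows as well.\<close>

definition psi_caputo_solution ::
  "real \<Rightarrow> (real \<Rightarrow> real) \<Rightarrow> real \<Rightarrow> ('a::euclidean_space \<Rightarrow> 'a) \<Rightarrow> 'a \<Rightarrow> (real \<Rightarrow> 'a) \<Rightarrow> bool" where
  "psi_caputo_solution l \<psi> \<alpha> F z0 z \<longleftrightarrow>
     continuous_on {l..} z \<and> locally_AC l z \<and> z l = z0 \<and>
     (\<forall>t>l. psi_caputo_exists l \<psi> \<alpha> z t \<and> psi_caputo l \<psi> \<alpha> z t = F (z t))"

definition psi_mean ::
  "real \<Rightarrow> (real \<Rightarrow> real) \<Rightarrow> real \<Rightarrow> (real \<Rightarrow> 'a::euclidean_space) \<Rightarrow> real \<Rightarrow> 'a" where
  "psi_mean l \<psi> \<alpha> z t =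
     (Gamma (\<alpha> + 1) / (\<psi> t - \<psi> l) powr \<alpha>) *\<^sub>R psi_RL_integral l \<psi> \<alpha> z t"

definition min_value :: "('a \<Rightarrow> real) \<Rightarrow> real" where
  "min_value f = (LEAST v. v \<in> range f)"

end

theory Submission
  imports Defs
begin

text \<open>The squared distance \<open>V = |z - p|\<^sup>2 / 2\<close> to a critical point \<open>p\<close> is a Lyapunov function. For an ordinary
  gradient flow \<open>V' = (z - p) \<bullet> z'\<close>; for the Caputo derivative the inequality
  \<open>D\<^sup>\<alpha> V \<le> (z - p) \<bullet> D\<^sup>\<alpha> z\<close> (\<open>caputo_square_inequality\<close>) takes its place. Together with the gradient
  inequality for the convex function \<open>f\<close> it gives \<open>D\<^sup>\<alpha> V \<le> - \<beta> (f(z) - f\<^sub>*)\<close>. Applying \<open>I\<^sup>\<alpha>\<close>, which inverts the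
  Caputo derivative because the kernels of orders \<open>\<alpha>\<close> and \<open>1 - \<alpha>\<close> convolve to a constant
  (\<open>caputo_kernel_inverse\<close>), yields \<open>V(t) + \<beta> I\<^sup>\<alpha> (f(z) - f\<^sub>*)(t) \<le> V(l)\<close> for all \<open>t\<close> (\<open>lyapunov_descent\<close>).

  Everything follows from this estimate. The first summand bounds \<open>z\<close>. The second bounds
  \<open>I\<^sup>\<alpha> (f(z) - f\<^sub>*)\<close>; dividing by \<open>(\<psi> t - \<psi> l)\<^sup>\<alpha>\<close> shows that the weighted mean of \<open>f(z) - f\<^sub>*\<close> is
  \<open>O(\<psi>\<^sup>-\<^sup>\<alpha>)\<close>, and by Jensen's inequality (\<open>psi_mean_jensen\<close>) the same holds for \<open>f\<close> at the mean of \<open>z\<close>. Since this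
  weighted mean tends to zero, \<open>f(z)\<close> comes arbitrarily close to \<open>f\<^sub>*\<close>, and compactness supplies a sequence
  converging to a minimiser, which is a critical point.

  A solution is only locally absolutely continuous, so \<open>D\<^sup>\<alpha> V\<close> is never formed as a derivative of \<open>V\<close>: the
  argument works with the locally integrable function \<open>(z - p) \<bullet> z'\<close>, whose primitive is \<open>V\<close>, and with
  inequalities valid for almost every \<open>t\<close>.\<close>

section \<open>Integration on real intervals\<close>

lemma absolutely_integrable_iff_integrable_lebesgue_on:
  fixes f :: "'a::euclidean_space \<Rightarrow> 'b::euclidean_space"
  assumes "S \<in> sets lebesgue"
  shows "f absolutely_integrable_on S \<longleftrightarrow> integrable (lebesgue_on S) f"
  using assms by (simp add: set_integrable_def integrable_restrict_space)

lemma absolutely_integrable_on_restrict: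
  fixes f :: "'a::euclidean_space \<Rightarrow> 'b::euclidean_space"
  assumes "S \<subseteq> T"
  shows "(\<lambda>x. if x \<in> S then f x else 0) absolutely_integrable_on T \<longleftrightarrow> f absolutely_integrable_on S"
proof -
  have "(\<lambda>x. indicat_real T x *\<^sub>R (if x \<in> S then f x else 0)) = (\<lambda>x. indicat_real S x *\<^sub>R f x)"
    using assms by (auto simp: indicator_def fun_eq_iff)
  then show ?thesis by (simp add: set_integrable_def)
qed

lemma integral_on_restrict:
  fixes f :: "'a::euclidean_space \<Rightarrow> 'b::euclidean_space"
  assumes "S \<subseteq> T"
  shows "integral T (\<lambda>x. if x \<in> S then f x else 0) = integral S f"
  using assms by (metis integral_restrict_Int inf.absorb_iff1 inf.commute)

lemma AE_lebesgue_on_iff_negligible: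
  assumes "S \<in> sets lebesgue"
  shows "(AE x in lebesgue_on S. P x) \<longleftrightarrow> negligible {x \<in> S. \<not> P x}"
proof -
  have "(AE x in lebesgue_on S. P x) \<longleftrightarrow> (AE x in lebesgue. x \<in> S \<longrightarrow> P x)"
    using assms by (simp add: AE_restrict_space_iff)
  also have "\<dots> \<longleftrightarrow> negligible {x \<in> S. \<not> P x}"
  proof
    assume "AE x in lebesgue. x \<in> S \<longrightarrow> P x"
    then obtain N where "N \<in> null_sets lebesgue" "{x. \<not> (x \<in> S \<longrightarrow> P x)} \<subseteq> N"
      by (auto simp: eventually_ae_filter)
    then show "negligible {x \<in> S. \<not> P x}"
      by (auto simp: negligible_iff_null_sets[symmetric] intro: negligible_subset)
  next
    assume "negligible {x \<in> S. \<not> P x}"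
    then show "AE x in lebesgue. x \<in> S \<longrightarrow> P x"
      by (intro AE_I'[of "{x \<in> S. \<not> P x}"]) (auto simp: negligible_iff_null_sets)
  qed
  finally show ?thesis .
qed

lemma absolutely_integrable_inner_continuous:
  fixes u g :: "real \<Rightarrow> 'a::euclidean_space"
  assumes u: "continuous_on {a..b} u" and g: "g absolutely_integrable_on {a..b}"
  shows "(\<lambda>s. u s \<bullet> g s) absolutely_integrable_on {a..b}"
proof (rule absolutely_integrable_bounded_measurable_product[where h = "(\<bullet>)"])
  show "bilinear ((\<bullet>) :: 'a \<Rightarrow> 'a \<Rightarrow> real)"
    by (simp add: bilinear_def linear_iff inner_add_left inner_add_right)
  show "u \<in> borel_measurable (lebesgue_on {a..b})"
    using u by (rule continuous_imp_measurable_on_sets_lebesgue) simp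
  show "bounded (u ` {a..b})"
    using u by (intro compact_imp_bounded compact_continuous_image) auto
qed (use g in auto)

lemma integral_le_off_negligible:
  fixes f g :: "'a::euclidean_space \<Rightarrow> real"
  assumes f: "f integrable_on S" and g: "g integrable_on S" and N: "negligible N"
    and le: "\<And>x. x \<in> S - N \<Longrightarrow> f x \<le> g x"
  shows "integral S f \<le> integral S g"
proof -
  let ?g = "\<lambda>x. if x \<in> N then f x else g x"
  have "integral S f \<le> integral S ?g"
    using le by (intro integral_le f integrable_spike[OF g N]) auto
  also have "\<dots> = integral S g"
    by (rule integral_spike[OF N]) auto
  finally show ?thesis .
qed

text \<open>Exchange of the order of integration over the triangle \<open>a \<le> s \<le> t \<le> b\<close>. The majorant \<open>B\<close> of the
  iterated norm integrals gives integrability on the whole square after extension by zero. The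
  almost-everywhere statement is what makes singular inner integrals meaningful: a Caputo integrand
  need not be absolutely integrable for every upper limit \<open>t\<close>.\<close>

lemma Fubini_triangle:
  fixes H :: "real \<Rightarrow> real \<Rightarrow> 'b::euclidean_space"
  assumes meas: "(\<lambda>(s, t). H t s) \<in> borel_measurable (lebesgue_on {a..b} \<Otimes>\<^sub>M lebesgue_on {a..b})"
    and sec: "\<And>s. s \<in> {a..b} \<Longrightarrow> (\<lambda>t. H t s) absolutely_integrable_on {s..b}"
    and bound: "\<And>s. s \<in> {a..b} \<Longrightarrow> integral {s..b} (\<lambda>t. norm (H t s)) \<le> B s"
    and B: "B absolutely_integrable_on {a..b}"
  shows "AE t in lebesgue_on {a..b}. H t absolutely_integrable_on {a..t}"
    and "(\<lambda>t. integral {a..t} (H t)) absolutely_integrable_on {a..b}"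
    and "integral {a..b} (\<lambda>t. integral {a..t} (H t)) =
         integral {a..b} (\<lambda>s. integral {s..b} (\<lambda>t. H t s))"
proof -
  let ?\<mu> = "lebesgue_on {a..b}"
  interpret M: finite_measure ?\<mu> by (rule finite_measure_lebesgue_on) simp
  interpret P: pair_sigma_finite ?\<mu> ?\<mu> ..
  define G where "G s t = (if s \<le> t then H t s else 0)" for s t
  have id [measurable]: "(\<lambda>x. x) \<in> borel_measurable ?\<mu>"
    using id_borel_measurable_lebesgue_on[of "{a..b}"] by (simp add: id_def)
  have measG: "(\<lambda>(s, t). G s t) \<in> borel_measurable (?\<mu> \<Otimes>\<^sub>M ?\<mu>)"
    using meas unfolding G_def case_prod_beta by measurable
  have G_row: "G s t = (if t \<in> {s..b} then H t s else 0)" if "t \<in> {a..b}" for s t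
    using that by (auto simp: G_def)
  have G_col: "G s t = (if s \<in> {a..t} then H t s else 0)" if "s \<in> {a..b}" for s t
    using that by (auto simp: G_def)
  have row: "integrable ?\<mu> (G s)" "integral\<^sup>L ?\<mu> (G s) = integral {s..b} (\<lambda>t. H t s)"
    "(\<integral>t. norm (G s t) \<partial>?\<mu>) = integral {s..b} (\<lambda>t. norm (H t s))" if s: "s \<in> {a..b}" for s
  proof -
    have sub: "{s..b} \<subseteq> {a..b}" using s by auto
    have "(\<lambda>t. if t \<in> {s..b} then H t s else 0) absolutely_integrable_on {a..b}"
      using sec[OF s] absolutely_integrable_on_restrict[OF sub, of "\<lambda>t. H t s"] by simp
    then have i: "integrable ?\<mu> (\<lambda>t. if t \<in> {s..b} then H t s else 0)"
      by (simp add: absolutely_integrable_iff_integrable_lebesgue_on)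
    then show i2: "integrable ?\<mu> (G s)"
      by (rule Bochner_Integration.integrable_cong[THEN iffD1, rotated -1]) (use G_row in auto)
    have "integral\<^sup>L ?\<mu> (G s) = integral {a..b} (G s)"
      by (rule lebesgue_integral_eq_integral[OF i2]) simp
    also have "\<dots> = integral {a..b} (\<lambda>t. if t \<in> {s..b} then H t s else 0)"
      using G_row by (intro integral_cong) auto
    finally show "integral\<^sup>L ?\<mu> (G s) = integral {s..b} (\<lambda>t. H t s)"
      using integral_on_restrict[OF sub, of "\<lambda>t. H t s"] by simp
    have "(\<integral>t. norm (G s t) \<partial>?\<mu>) = integral {a..b} (\<lambda>t. norm (G s t))"
      by (rule lebesgue_integral_eq_integral[OF integrable_norm[OF i2]]) simp
    also have "\<dots> = integral {a..b} (\<lambda>t. if t \<in> {s..b} then norm (H t s) else 0)"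
      using G_row by (intro integral_cong) auto
    finally show "(\<integral>t. norm (G s t) \<partial>?\<mu>) = integral {s..b} (\<lambda>t. norm (H t s))"
      using integral_on_restrict[OF sub, of "\<lambda>t. norm (H t s)"] by simp
  qed
  have "integrable ?\<mu> (\<lambda>s. \<integral>t. norm (G s t) \<partial>?\<mu>)"
  proof (rule Bochner_Integration.integrable_bound)
    show "integrable ?\<mu> B"
      using B by (simp add: absolutely_integrable_iff_integrable_lebesgue_on)
    show "(\<lambda>s. \<integral>t. norm (G s t) \<partial>?\<mu>) \<in> borel_measurable ?\<mu>"
      using measG by (intro M.borel_measurable_lebesgue_integral) (simp add: case_prod_beta)
    show "AE s in ?\<mu>. norm (\<integral>t. norm (G s t) \<partial>?\<mu>) \<le> norm (B s)"
    proof (rule AE_I2)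
      fix s assume "s \<in> space ?\<mu>"
      then have "(\<integral>t. norm (G s t) \<partial>?\<mu>) \<le> B s" using row(3) bound by simp
      moreover have "0 \<le> (\<integral>t. norm (G s t) \<partial>?\<mu>)" by simp
      ultimately show "norm (\<integral>t. norm (G s t) \<partial>?\<mu>) \<le> norm (B s)" by simp
    qed
  qed
  then have intG: "integrable (?\<mu> \<Otimes>\<^sub>M ?\<mu>) (\<lambda>(s, t). G s t)"
    using measG row(1) by (intro P.Fubini_integrable) (auto intro!: AE_I2)
  have col: "H t absolutely_integrable_on {a..t} \<and> (\<integral>s. G s t \<partial>?\<mu>) = integral {a..t} (H t)"
    if t: "t \<in> {a..b}" and i: "integrable ?\<mu> (\<lambda>s. G s t)" for t
  proof -
    have sub: "{a..t} \<subseteq> {a..b}" using t by auto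
    have "integrable ?\<mu> (\<lambda>s. if s \<in> {a..t} then H t s else 0)"
      using i by (rule Bochner_Integration.integrable_cong[THEN iffD1, rotated -1]) (use G_col in auto)
    then have 1: "H t absolutely_integrable_on {a..t}"
      using absolutely_integrable_on_restrict[OF sub, of "H t"]
      by (simp add: absolutely_integrable_iff_integrable_lebesgue_on)
    have "(\<integral>s. G s t \<partial>?\<mu>) = integral {a..b} (\<lambda>s. G s t)"
      by (rule lebesgue_integral_eq_integral[OF i]) simp
    also have "\<dots> = integral {a..b} (\<lambda>s. if s \<in> {a..t} then H t s else 0)"
      using G_col by (intro integral_cong) auto
    finally show ?thesis using 1 integral_on_restrict[OF sub, of "H t"] by simp
  qed
  have ae: "AE t in ?\<mu>. t \<in> {a..b} \<and> integrable ?\<mu> (\<lambda>s. G s t)"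
    using P.AE_integrable_snd[OF intG] AE_space[of ?\<mu>] by eventually_elim auto
  show "AE t in ?\<mu>. H t absolutely_integrable_on {a..t}"
    using ae by eventually_elim (use col in blast)
  have ae2: "AE t in ?\<mu>. (\<integral>s. G s t \<partial>?\<mu>) = integral {a..t} (H t)"
    using ae by eventually_elim (use col in blast)
  have i3: "integrable ?\<mu> (\<lambda>t. \<integral>s. G s t \<partial>?\<mu>)"
    using P.integrable_snd[OF intG] .
  then have i3': "(\<lambda>t. \<integral>s. G s t \<partial>?\<mu>) absolutely_integrable_on {a..b}"
    by (simp add: absolutely_integrable_iff_integrable_lebesgue_on)
  have neg: "negligible {t \<in> {a..b}. (\<integral>s. G s t \<partial>?\<mu>) \<noteq> integral {a..t} (H t)}"
    using ae2 by (simp add: AE_lebesgue_on_iff_negligible)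
  show "(\<lambda>t. integral {a..t} (H t)) absolutely_integrable_on {a..b}"
    by (rule absolutely_integrable_spike[OF i3' neg]) auto
  have "integral {a..b} (\<lambda>t. integral {a..t} (H t)) = integral {a..b} (\<lambda>t. \<integral>s. G s t \<partial>?\<mu>)"
    by (rule integral_spike[OF neg]) auto
  also have "\<dots> = (\<integral>t. (\<integral>s. G s t \<partial>?\<mu>) \<partial>?\<mu>)"
    using lebesgue_integral_eq_integral[OF i3] by simp
  also have "\<dots> = (\<integral>s. (\<integral>t. G s t \<partial>?\<mu>) \<partial>?\<mu>)"
    by (rule P.Fubini_integral[OF intG])
  also have "\<dots> = integral {a..b} (\<lambda>s. \<integral>t. G s t \<partial>?\<mu>)"
    by (rule lebesgue_integral_eq_integral[OF P.integrable_fst[OF intG]]) simp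
  also have "\<dots> = integral {a..b} (\<lambda>s. integral {s..b} (\<lambda>t. H t s))"
    using row(2) by (intro integral_cong) auto
  finally show "integral {a..b} (\<lambda>t. integral {a..t} (H t)) =
         integral {a..b} (\<lambda>s. integral {s..b} (\<lambda>t. H t s))" .
qed

section \<open>Monotone kernels and squares of primitives\<close>

text \<open>A nonnegative nondecreasing kernel \<open>K\<close> is a superposition of indicators of end pieces \<open>{r..b}\<close>, so
  \<open>\<integral> K \<phi>\<close> is a superposition of tails of \<open>\<phi>\<close>. For bounded \<open>K\<close> this is the second mean value theorem;
  the kernel of interest blows up at \<open>b\<close>, so it is truncated at height \<open>n\<close> and dominated convergence
  removes the truncation.\<close>

lemma integral_monotone_kernel_nonneg:
  fixes K \<phi> :: "real \<Rightarrow> real"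
  assumes "a \<le> b"
    and mono: "\<And>x y. a \<le> x \<Longrightarrow> x \<le> y \<Longrightarrow> y < b \<Longrightarrow> K x \<le> K y"
    and nonneg: "\<And>x. a \<le> x \<Longrightarrow> x < b \<Longrightarrow> 0 \<le> K x"
    and phi: "\<phi> integrable_on {a..b}"
    and K\<phi>: "(\<lambda>x. K x * \<phi> x) absolutely_integrable_on {a..b}"
    and tails: "\<And>r. r \<in> {a..b} \<Longrightarrow> 0 \<le> integral {r..b} \<phi>"
  shows "0 \<le> integral {a..b} (\<lambda>x. K x * \<phi> x)"
proof -
  \<comment> \<open>the value \<open>n\<close> at \<open>b\<close> keeps the truncated kernel monotone whatever \<open>K b\<close> is\<close>
  define Kn where "Kn n x = (if x < b then min (K x) (real n) else real n)" for n x
  have Kn_mono: "Kn n x \<le> Kn n y" if "a \<le> x" "x \<le> y" "y \<le> b" for n x y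
    using that mono[of x y] unfolding Kn_def by (auto simp: min_def)
  have Kn_nonneg: "0 \<le> Kn n x" if "a \<le> x" for n x
    using that nonneg[of x] unfolding Kn_def by (auto simp: min_def)
  have Kn_int: "(\<lambda>x. Kn n x * \<phi> x) integrable_on {a..b}" "0 \<le> integral {a..b} (\<lambda>x. Kn n x * \<phi> x)" for n
  proof -
    obtain c where c: "c \<in> {a..b}" and
      h: "((\<lambda>x. Kn n x * \<phi> x) has_integral
           (Kn n a * integral {a..c} \<phi> + Kn n b * integral {c..b} \<phi>)) {a..b}"
      using second_mean_value_theorem_full[OF phi \<open>a \<le> b\<close>, of "Kn n"] Kn_mono by blast
    then show "(\<lambda>x. Kn n x * \<phi> x) integrable_on {a..b}" by blast
    have "integral {a..c} \<phi> + integral {c..b} \<phi> = integral {a..b} \<phi>"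
      using c phi by (intro Henstock_Kurzweil_Integration.integral_combine) auto
    then have "Kn n a * integral {a..c} \<phi> + Kn n b * integral {c..b} \<phi> =
        Kn n a * integral {a..b} \<phi> + (Kn n b - Kn n a) * integral {c..b} \<phi>"
      by (auto simp: algebra_simps simp flip: distrib_left)
    also have "\<dots> \<ge> 0"
      using tails[of a] tails[OF c] Kn_nonneg[of a n] Kn_mono[of a b n] \<open>a \<le> b\<close> by simp
    finally show "0 \<le> integral {a..b} (\<lambda>x. Kn n x * \<phi> x)"
      using h by (simp add: integral_unique)
  qed
  let ?S = "{a..<b}"
  have AI: "(\<lambda>x. \<bar>K x * \<phi> x\<bar>) integrable_on {a..b}"
    using K\<phi> by (simp add: absolutely_integrable_on_def)
  have spike: "f integrable_on {a..b} \<longleftrightarrow> f integrable_on ?S" "integral {a..b} f = integral ?S f"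
    for f :: "real \<Rightarrow> real"
  proof -
    have "negligible (sym_diff {a..b} ?S)" by (rule negligible_subset[of "{b}"]) auto
    then show "f integrable_on {a..b} \<longleftrightarrow> f integrable_on ?S" by (rule integrable_spike_set_eq)
    show "integral {a..b} f = integral ?S f"
      by (rule integral_spike_set; rule negligible_subset[of "{b}"]) auto
  qed
  have lim: "(\<lambda>n. Kn n x * \<phi> x) \<longlonglongrightarrow> K x * \<phi> x" if x: "x \<in> ?S" for x
  proof -
    obtain N where N: "K x \<le> real N" using real_arch_simple by blast
    have "\<forall>\<^sub>F n in sequentially. Kn n x * \<phi> x = K x * \<phi> x"
      using eventually_ge_at_top[of N]
    proof eventually_elim
      case (elim n)
      then have "K x \<le> real n" using N by linarith
      then show ?case using x by (simp add: Kn_def)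
    qed
    then show ?thesis by (rule tendsto_eventually)
  qed
  have bd: "norm (Kn n x * \<phi> x) \<le> \<bar>K x * \<phi> x\<bar>" if x: "x \<in> ?S" for n x
    using x nonneg[of x] Kn_nonneg[of x n] by (auto simp: abs_mult Kn_def intro!: mult_right_mono)
  have "(\<lambda>n. integral ?S (\<lambda>x. Kn n x * \<phi> x)) \<longlonglongrightarrow> integral ?S (\<lambda>x. K x * \<phi> x)"
    by (rule dominated_convergence(2)[of _ _ "\<lambda>x. \<bar>K x * \<phi> x\<bar>"])
      (use Kn_int AI spike bd lim in auto)
  then show ?thesis
    using Kn_int(2) spike by (metis (lifting) LIMSEQ_le_const)
qed

text \<open>With \<open>G s = \<integral> g\<close> over \<open>{s..b}\<close>, this is \<open>\<integral> G \<bullet> (- G') = |G a|\<^sup>2 / 2\<close> for a merely integrable \<open>g\<close>. The product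
  \<open>g t \<bullet> g s\<close> is symmetric, so its integrals over the two triangles of the square agree by Fubini, while
  their sum is \<open>|\<integral> g|\<^sup>2\<close>.\<close>

lemma integral_inner_primitive:
  fixes g :: "real \<Rightarrow> 'a::euclidean_space"
  assumes g: "g absolutely_integrable_on {a..b}"
  shows "(\<lambda>s. integral {s..b} g \<bullet> g s) absolutely_integrable_on {a..b}"
    and "integral {a..b} (\<lambda>s. integral {s..b} g \<bullet> g s) = (norm (integral {a..b} g))\<^sup>2 / 2"
proof -
  let ?\<mu> = "lebesgue_on {a..b}"
  have g_sub: "g absolutely_integrable_on {c..d}" if "a \<le> c" "d \<le> b" for c d
    by (rule set_integrable_subset[OF g]) (use that in auto)
  have g_int: "g integrable_on {c..d}" if "a \<le> c" "d \<le> b" for c d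
    using set_lebesgue_integral_eq_integral(1)[OF g_sub[OF that]] .
  have meas_g: "g \<in> borel_measurable ?\<mu>"
    using g by (simp add: absolutely_integrable_iff_integrable_lebesgue_on)
  have meas: "(\<lambda>(s, t). g t \<bullet> g s) \<in> borel_measurable (?\<mu> \<Otimes>\<^sub>M ?\<mu>)"
    using meas_g by measurable
  have inner_int: "integral {c..d} (\<lambda>s. v \<bullet> g s) = v \<bullet> integral {c..d} g"
    "integral {c..d} (\<lambda>s. g s \<bullet> v) = integral {c..d} g \<bullet> v" if "a \<le> c" "d \<le> b" for c d v
    using integral_linear[OF g_int[OF that] bounded_linear_inner_right[of v]]
      integral_linear[OF g_int[OF that] bounded_linear_inner_left[of v]] by (simp_all add: o_def)
  have sec: "(\<lambda>t. g t \<bullet> g s) absolutely_integrable_on {s..b}" if "s \<in> {a..b}" for s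
    using absolutely_integrable_linear[OF g_sub bounded_linear_inner_left[of "g s"], of s b] that
    by (simp add: o_def)
  define N where "N = integral {a..b} (\<lambda>t. norm (g t))"
  have bound: "integral {s..b} (\<lambda>t. norm (g t \<bullet> g s)) \<le> N * norm (g s)" if s: "s \<in> {a..b}" for s
  proof -
    have ni: "(\<lambda>t. norm (g t)) integrable_on {c..d}" if "a \<le> c" "d \<le> b" for c d
      using g_sub[OF that] by (simp add: absolutely_integrable_on_def)
    have "integral {s..b} (\<lambda>t. norm (g t \<bullet> g s)) \<le> integral {s..b} (\<lambda>t. norm (g t) * norm (g s))"
      using sec[OF s] ni[of s b] s
      by (intro integral_le integrable_on_mult_left)
        (auto simp: absolutely_integrable_on_def Cauchy_Schwarz_ineq2)
    also have "\<dots> = integral {s..b} (\<lambda>t. norm (g t)) * norm (g s)" by simp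
    also have "\<dots> \<le> N * norm (g s)"
      unfolding N_def using s ni[of s b] ni[of a b]
      by (intro mult_right_mono integral_subset_le) auto
    finally show ?thesis .
  qed
  have B: "(\<lambda>s. N * norm (g s)) absolutely_integrable_on {a..b}"
    using absolutely_integrable_norm[OF g] by (simp add: o_def)
  have F: "(\<lambda>t. integral {a..t} (\<lambda>s. g t \<bullet> g s)) absolutely_integrable_on {a..b}"
    "integral {a..b} (\<lambda>t. integral {a..t} (\<lambda>s. g t \<bullet> g s)) =
     integral {a..b} (\<lambda>s. integral {s..b} (\<lambda>t. g t \<bullet> g s))"
    by (rule Fubini_triangle(2,3)[OF meas sec bound B]; assumption)+
  let ?I = "integral {a..b} g"
  have low: "integral {a..t} (\<lambda>s. g t \<bullet> g s) = g t \<bullet> integral {a..t} g" if "t \<in> {a..b}" for t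
    using inner_int that by simp
  have up: "integral {s..b} g = ?I - integral {a..s} g" if "s \<in> {a..b}" for s
    using Henstock_Kurzweil_Integration.integral_combine[of a s b g] g_int[of a b] that
    by (auto simp: algebra_simps)
  have up': "integral {s..b} g \<bullet> g s = ?I \<bullet> g s - g s \<bullet> integral {a..s} g" if "s \<in> {a..b}" for s
    by (subst up[OF that]) (simp add: inner_diff_left inner_diff_right inner_commute)
  have i1: "(\<lambda>t. g t \<bullet> integral {a..t} g) absolutely_integrable_on {a..b}"
    by (rule absolutely_integrable_spike[OF F(1) negligible_empty]) (use low in auto)
  have i2: "(\<lambda>s. ?I \<bullet> g s) absolutely_integrable_on {a..b}"
    using absolutely_integrable_linear[OF g bounded_linear_inner_right[of ?I]] by (simp add: o_def)
  have "(\<lambda>s. ?I \<bullet> g s - g s \<bullet> integral {a..s} g) absolutely_integrable_on {a..b}"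
    by (rule set_integral_diff(1)[OF i2 i1])
  then show i3: "(\<lambda>s. integral {s..b} g \<bullet> g s) absolutely_integrable_on {a..b}"
    by (rule absolutely_integrable_spike[OF _ negligible_empty])
      (simp add: up')
  have "integral {a..b} (\<lambda>s. integral {s..b} g \<bullet> g s) =
      integral {a..b} (\<lambda>s. integral {s..b} (\<lambda>t. g t \<bullet> g s))"
    using inner_int by (intro integral_cong) auto
  also have "\<dots> = integral {a..b} (\<lambda>t. g t \<bullet> integral {a..t} g)"
    unfolding F(2)[symmetric] by (rule integral_cong) (rule low)
  finally have eq: "integral {a..b} (\<lambda>s. integral {s..b} g \<bullet> g s) =
      integral {a..b} (\<lambda>t. g t \<bullet> integral {a..t} g)" .
  have "integral {a..b} (\<lambda>s. integral {s..b} g \<bullet> g s) + integral {a..b} (\<lambda>t. g t \<bullet> integral {a..t} g)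
      = integral {a..b} (\<lambda>s. integral {s..b} g \<bullet> g s + g s \<bullet> integral {a..s} g)"
    using i1 i3 by (intro integral_add[symmetric]) (auto simp: absolutely_integrable_on_def)
  also have "\<dots> = integral {a..b} (\<lambda>s. ?I \<bullet> g s)"
    using up' by (intro integral_cong) simp
  also have "\<dots> = (norm ?I)\<^sup>2"
    using inner_int by (simp add: power2_norm_eq_inner)
  finally show "integral {a..b} (\<lambda>s. integral {s..b} g \<bullet> g s) = (norm ?I)\<^sup>2 / 2"
    using eq by simp
qed

section \<open>Squared distances along absolutely continuous curves\<close>

context
  fixes l :: real and z :: "real \<Rightarrow> 'a::euclidean_space"
  assumes AC: "locally_AC l z"
begin

lemma locally_AC_absolutely_integrable:
  "l \<le> r \<Longrightarrow> hderiv l z absolutely_integrable_on {r..t}"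
  using AC unfolding locally_AC_def
  by (cases "l \<le> t") (auto intro: set_integrable_subset[of _ "{l..t}"])

lemma locally_AC_integral:
  assumes "l \<le> r" "r \<le> t"
  shows "integral {r..t} (hderiv l z) = z t - z r"
proof -
  have "integral {l..r} (hderiv l z) + integral {r..t} (hderiv l z) = integral {l..t} (hderiv l z)"
    using locally_AC_absolutely_integrable[of l t] assms
    by (intro Henstock_Kurzweil_Integration.integral_combine) (auto simp: absolutely_integrable_on_def)
  moreover have zr: "z r = z l + integral {l..r} (hderiv l z)" and zt: "z t = z l + integral {l..t} (hderiv l z)"
    using AC assms unfolding locally_AC_def by (meson order.trans)+
  have "z t - z r = integral {l..t} (hderiv l z) - integral {l..r} (hderiv l z)"
    by (subst zr, subst zt) (rule add_diff_cancel_left)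
  ultimately show ?thesis by (metis add_diff_cancel_left')
qed

lemma increment_inner_derivative:
  assumes "l \<le> r" "r \<le> t"
  shows "(\<lambda>s. (z t - z s) \<bullet> hderiv l z s) absolutely_integrable_on {r..t}"
    and "integral {r..t} (\<lambda>s. (z t - z s) \<bullet> hderiv l z s) = (norm (z t - z r))\<^sup>2 / 2"
proof -
  note P = integral_inner_primitive[OF locally_AC_absolutely_integrable[OF assms(1), of t]]
  have eq: "integral {s..t} (hderiv l z) = z t - z s" if "s \<in> {r..t}" for s
    using that assms by (intro locally_AC_integral) auto
  show "(\<lambda>s. (z t - z s) \<bullet> hderiv l z s) absolutely_integrable_on {r..t}"
    by (rule absolutely_integrable_spike[OF P(1) negligible_empty]) (simp add: eq)
  have "integral {r..t} (\<lambda>s. (z t - z s) \<bullet> hderiv l z s) =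
      integral {r..t} (\<lambda>s. integral {s..t} (hderiv l z) \<bullet> hderiv l z s)"
    by (intro integral_cong) (simp add: eq)
  also have "\<dots> = (norm (integral {r..t} (hderiv l z)))\<^sup>2 / 2" by (rule P(2))
  also have "integral {r..t} (hderiv l z) = z t - z r" using assms by (rule locally_AC_integral)
  finally show "integral {r..t} (\<lambda>s. (z t - z s) \<bullet> hderiv l z s) = (norm (z t - z r))\<^sup>2 / 2" .
qed

text \<open>The fundamental theorem of calculus for \<open>|z - p|\<^sup>2 / 2\<close>. Writing \<open>z s - p = (z t - p) - (z t - z s)\<close> reduces it to
  \<open>increment_inner_derivative\<close>: against the constant factor \<open>z t - p\<close> the derivative \<open>z'\<close> integrates directly.\<close>

lemma square_distance_primitive:
  assumes "l \<le> t"
  shows "(\<lambda>s. (z s - p) \<bullet> hderiv l z s) absolutely_integrable_on {l..t}"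
    and "integral {l..t} (\<lambda>s. (z s - p) \<bullet> hderiv l z s) = (norm (z t - p))\<^sup>2 / 2 - (norm (z l - p))\<^sup>2 / 2"
proof -
  let ?g = "hderiv l z"
  note I = increment_inner_derivative[OF order.refl assms]
  have g: "?g absolutely_integrable_on {l..t}" by (rule locally_AC_absolutely_integrable) simp
  have c: "(\<lambda>s. (z t - p) \<bullet> ?g s) absolutely_integrable_on {l..t}"
    using absolutely_integrable_linear[OF g bounded_linear_inner_right[of "z t - p"]] by (simp add: o_def)
  have eq: "(z s - p) \<bullet> ?g s = (z t - p) \<bullet> ?g s - (z t - z s) \<bullet> ?g s" for s
    by (simp add: inner_diff_left)
  show "(\<lambda>s. (z s - p) \<bullet> ?g s) absolutely_integrable_on {l..t}"
    unfolding eq by (rule set_integral_diff(1)[OF c I(1)])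
  have "integral {l..t} (\<lambda>s. (z s - p) \<bullet> ?g s) =
      integral {l..t} (\<lambda>s. (z t - p) \<bullet> ?g s) - integral {l..t} (\<lambda>s. (z t - z s) \<bullet> ?g s)"
    unfolding eq using c I(1) by (intro integral_diff) (auto simp: absolutely_integrable_on_def)
  also have "integral {l..t} (\<lambda>s. (z t - p) \<bullet> ?g s) = (z t - p) \<bullet> integral {l..t} ?g"
    using integral_linear[OF set_lebesgue_integral_eq_integral(1)[OF g] bounded_linear_inner_right[of "z t - p"]]
    by (simp add: o_def)
  also have "integral {l..t} ?g = z t - z l"
    using assms by (intro locally_AC_integral) auto
  finally have *: "integral {l..t} (\<lambda>s. (z s - p) \<bullet> ?g s) = (z t - p) \<bullet> (z t - z l) - (norm (z t - z l))\<^sup>2 / 2"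
    using I(2) by simp
  define u where "u = z t - p"
  define v where "v = z l - p"
  have uv: "z t - z l = u - v" by (simp add: u_def v_def)
  show "integral {l..t} (\<lambda>s. (z s - p) \<bullet> ?g s) = (norm (z t - p))\<^sup>2 / 2 - (norm (z l - p))\<^sup>2 / 2"
    unfolding * uv unfolding u_def[symmetric] v_def[symmetric] power2_norm_eq_inner
    by (simp add: inner_diff_left inner_diff_right inner_commute[of v u] field_simps)
qed

end

section \<open>Kernels in the time scale of the function psi\<close>

text \<open>The function \<open>\<psi>\<close> acts as a clock: in the time variable \<open>\<psi> t\<close> the operators are the classical
  Riemann-Liouville and Caputo ones.\<close>

locale psi_clock =
  fixes l :: real and \<psi> :: "real \<Rightarrow> real"
  assumes psi_strict_mono: "strict_mono_on {l..} \<psi>"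
    and C1: "C1_halfline l \<psi>"
    and deriv_pos: "\<And>t. l \<le> t \<Longrightarrow> 0 < hderiv l \<psi> t"
begin

lemma psi_less: "l \<le> s \<Longrightarrow> s < t \<Longrightarrow> \<psi> s < \<psi> t"
  using psi_strict_mono by (auto simp: strict_mono_on_def)

lemma psi_le: "l \<le> s \<Longrightarrow> s \<le> t \<Longrightarrow> \<psi> s \<le> \<psi> t"
  using psi_less[of s t] by (cases "s = t") auto

lemma psi_has_deriv: "l \<le> t \<Longrightarrow> (\<psi> has_field_derivative hderiv l \<psi> t) (at t within {l..})"
  using C1 unfolding C1_halfline_def hderiv_def
  by (simp add: vector_derivative_works has_real_derivative_iff_has_vector_derivative)

lemma psi_continuous: "continuous_on {l..} \<psi>"
  using psi_has_deriv by (metis DERIV_continuous continuous_on_eq_continuous_within atLeast_iff)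

lemma psi_continuous_hderiv: "continuous_on {l..} (hderiv l \<psi>)"
  using C1 by (simp add: C1_halfline_def)

lemma psi_measurable_lebesgue_on:
  assumes "l \<le> a"
  shows "\<psi> \<in> borel_measurable (lebesgue_on {a..b})"
    and "hderiv l \<psi> \<in> borel_measurable (lebesgue_on {a..b})"
  using assms by (auto intro!: continuous_imp_measurable_on_sets_lebesgue
      continuous_on_subset[OF psi_continuous] continuous_on_subset[OF psi_continuous_hderiv])

lemma weight_has_integral:
  assumes "l \<le> t" "0 < \<alpha>"
  shows "((\<lambda>s. (\<psi> t - \<psi> s) powr (\<alpha> - 1) * hderiv l \<psi> s) has_integral (\<psi> t - \<psi> l) powr \<alpha> / \<alpha>) {l..t}"
proof -
  have "((\<lambda>s. (\<psi> t - \<psi> s) powr (\<alpha> - 1) * hderiv l \<psi> s) has_integral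
      (- ((\<psi> t - \<psi> t) powr \<alpha> / \<alpha>)) - (- ((\<psi> t - \<psi> l) powr \<alpha> / \<alpha>))) {l..t}"
  proof (rule fundamental_theorem_of_calculus_interior[OF assms(1)])
    show "continuous_on {l..t} (\<lambda>s. - ((\<psi> t - \<psi> s) powr \<alpha> / \<alpha>))"
      using assms psi_le
      by (intro continuous_intros continuous_on_powr' continuous_on_subset[OF psi_continuous]) auto
    fix s assume s: "s \<in> {l<..<t}"
    have "(\<psi> has_field_derivative hderiv l \<psi> s) (at s within {l<..})"
      using psi_has_deriv[of s] s by (auto intro: DERIV_subset)
    then have d: "(\<psi> has_field_derivative hderiv l \<psi> s) (at s)"
      using s by (simp add: at_within_open[of s "{l<..}"])
    have "\<psi> s < \<psi> t" using psi_less s by simp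
    then have "((\<lambda>s. - ((\<psi> t - \<psi> s) powr \<alpha> / \<alpha>)) has_field_derivative
        (\<psi> t - \<psi> s) powr (\<alpha> - 1) * hderiv l \<psi> s) (at s)"
      using \<open>0 < \<alpha>\<close> by (auto intro!: derivative_eq_intros d simp: field_simps powr_diff)
    then show "((\<lambda>s. - ((\<psi> t - \<psi> s) powr \<alpha> / \<alpha>)) has_vector_derivative
        (\<psi> t - \<psi> s) powr (\<alpha> - 1) * hderiv l \<psi> s) (at s)"
      by (simp add: has_real_derivative_iff_has_vector_derivative)
  qed
  then show ?thesis using assms by simp
qed

lemma weight_nonneg: "l \<le> s \<Longrightarrow> 0 \<le> (\<psi> t - \<psi> s) powr \<gamma> * hderiv l \<psi> s"
  using deriv_pos[of s] by simp

lemma weight_absolutely_integrable: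
  assumes "l \<le> t" "0 < \<alpha>"
  shows "(\<lambda>s. (\<psi> t - \<psi> s) powr (\<alpha> - 1) * hderiv l \<psi> s) absolutely_integrable_on {l..t}"
  using weight_has_integral[OF assms] weight_nonneg
  by (intro nonnegative_absolutely_integrable_1) auto

lemma weight_mult_absolutely_integrable:
  fixes x :: "real \<Rightarrow> 'a::euclidean_space"
  assumes "l \<le> t" "0 < \<alpha>" "continuous_on {l..} x"
  shows "(\<lambda>s. ((\<psi> t - \<psi> s) powr (\<alpha> - 1) * hderiv l \<psi> s) *\<^sub>R x s) absolutely_integrable_on {l..t}"
proof -
  have c: "continuous_on {l..t} x" using assms(3) by (rule continuous_on_subset) auto
  show ?thesis
  proof (rule absolutely_integrable_bounded_measurable_product[where h = "\<lambda>v c. c *\<^sub>R v" and f = x])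
    show "bilinear (\<lambda>(v::'a) (c::real). c *\<^sub>R v)"
      by (simp add: bilinear_def linear_iff algebra_simps)
    show "x \<in> borel_measurable (lebesgue_on {l..t})"
      using c by (rule continuous_imp_measurable_on_sets_lebesgue) simp
    show "bounded (x ` {l..t})"
      using c by (intro compact_imp_bounded compact_continuous_image) auto
  qed (use weight_absolutely_integrable assms in auto)
qed

text \<open>The substitution \<open>u = (\<psi> r - \<psi> s) / (\<psi> t - \<psi> s)\<close> turns this into the Beta integral \<open>B(1 - \<alpha>, \<alpha>)\<close>. The
  powers of \<open>\<psi> t - \<psi> s\<close> cancel, so the value does not depend on \<open>s\<close> and \<open>t\<close>: the kernels of orders \<open>\<alpha>\<close> and
  \<open>1 - \<alpha>\<close> convolve to a constant.\<close>

lemma beta_kernel_has_integral: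
  assumes "l \<le> s" "s < t" "0 < \<alpha>" "\<alpha> < 1"
  defines "K \<equiv> \<lambda>r. (\<psi> t - \<psi> r) powr (\<alpha> - 1) * hderiv l \<psi> r * (\<psi> r - \<psi> s) powr (- \<alpha>)"
  shows "K absolutely_integrable_on {s..t}"
    and "integral {s..t} K = Gamma \<alpha> * Gamma (1 - \<alpha>)"
proof -
  define D where "D = \<psi> t - \<psi> s"
  have D: "D > 0" using psi_less assms by (simp add: D_def)
  define g where "g r = (\<psi> r - \<psi> s) / D" for r
  define h where "h u = u powr (- \<alpha>) * (1 - u) powr (\<alpha> - 1)" for u :: real
  have cont: "continuous_on {s..t} g"
    unfolding g_def using D assms by (intro continuous_intros continuous_on_subset[OF psi_continuous]) auto
  have img: "g ` {s..t} = {0..1}"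
  proof
    show "g ` {s..t} \<subseteq> {0..1}"
      using D psi_le assms by (auto simp: g_def D_def divide_simps)
    have "{g s..g t} \<subseteq> g ` {s..t}"
    proof
      fix y assume "y \<in> {g s..g t}"
      then show "y \<in> g ` {s..t}"
        using IVT'[of g s y t] cont \<open>s < t\<close> by (auto simp: image_def)
    qed
    then show "{0..1} \<subseteq> g ` {s..t}" using D by (simp add: g_def D_def)
  qed
  have inj: "inj_on g {s..t}"
  proof (rule linorder_inj_onI)
    fix x y assume "x < y" "x \<in> {s..t}" "y \<in> {s..t}"
    then show "g x \<noteq> g y" using psi_less[of x y] D assms by (simp add: g_def)
  qed auto
  have der: "(g has_field_derivative hderiv l \<psi> r / D) (at r within {s..t})" if "r \<in> {s..t}" for r
    unfolding g_def
    using D that assms by (auto intro!: derivative_eq_intros DERIV_subset[OF psi_has_deriv])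
  have "(h has_integral Beta (1 - \<alpha>) \<alpha>) {0..1}"
    using has_integral_Beta_real[of "1 - \<alpha>" \<alpha>] assms by (simp add: h_def[abs_def])
  then have "h absolutely_integrable_on g ` {s..t} \<and> integral (g ` {s..t}) h = Beta (1 - \<alpha>) \<alpha>"
    unfolding img by (auto simp: integral_unique h_def intro!: nonnegative_absolutely_integrable_1)
  then have *: "(\<lambda>r. \<bar>hderiv l \<psi> r / D\<bar> * h (g r)) absolutely_integrable_on {s..t} \<and>
      integral {s..t} (\<lambda>r. \<bar>hderiv l \<psi> r / D\<bar> * h (g r)) = Beta (1 - \<alpha>) \<alpha>"
    using has_absolute_integral_change_of_variables_1'[OF _ der inj, of h "Beta (1 - \<alpha>) \<alpha>"] by simp
  have eq: "\<bar>hderiv l \<psi> r / D\<bar> * h (g r) = K r" if r: "r \<in> {s..t}" for r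
  proof -
    have 0: "0 \<le> \<psi> r - \<psi> s" "0 \<le> \<psi> t - \<psi> r" using psi_le r assms by auto
    have "1 - g r = (\<psi> t - \<psi> r) / D" using D by (simp add: g_def D_def field_simps)
    then have "h (g r) = (\<psi> r - \<psi> s) powr (- \<alpha>) / D powr (- \<alpha>) * ((\<psi> t - \<psi> r) powr (\<alpha> - 1) / D powr (\<alpha> - 1))"
      using 0 D by (simp add: h_def g_def powr_divide)
    moreover have "D powr (- \<alpha>) * D powr (\<alpha> - 1) = 1 / D"
    proof -
      have "D powr (- \<alpha>) * D powr (\<alpha> - 1) = D powr (- 1)"
        by (subst powr_add[symmetric]) simp
      then show ?thesis using D by (simp add: powr_neg_one)
    qed
    ultimately have "h (g r) = (\<psi> r - \<psi> s) powr (- \<alpha>) * (\<psi> t - \<psi> r) powr (\<alpha> - 1) * D"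
      using D by (simp add: field_simps)
    moreover have "0 < hderiv l \<psi> r" using deriv_pos r assms by simp
    ultimately show ?thesis using D by (simp add: K_def)
  qed
  show "K absolutely_integrable_on {s..t}"
    by (rule absolutely_integrable_spike[OF *[THEN conjunct1] negligible_empty]) (use eq in simp)
  have "integral {s..t} K = integral {s..t} (\<lambda>r. \<bar>hderiv l \<psi> r / D\<bar> * h (g r))"
    by (rule integral_cong) (rule eq[symmetric])
  then have "integral {s..t} K = Beta (1 - \<alpha>) \<alpha>"
    using * by simp
  then show "integral {s..t} K = Gamma \<alpha> * Gamma (1 - \<alpha>)"
    by (simp add: Beta_def)
qed

text \<open>\<open>I\<^sup>\<alpha> I\<^sup>1\<^sup>-\<^sup>\<alpha> = I\<^sup>1\<close> for a locally integrable \<open>g\<close>, up to the normalising Gamma factors: after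
  exchanging the integrals the inner one is the constant Beta integral. The same exchange shows that
  the inner integrand is absolutely integrable for almost every \<open>t\<close>.\<close>

lemma caputo_kernel_inverse:
  fixes g :: "real \<Rightarrow> 'a::euclidean_space"
  assumes "0 < \<alpha>" "\<alpha> < 1" and g: "g absolutely_integrable_on {l..b}"
  defines "Q \<equiv> \<lambda>t. integral {l..t} (\<lambda>s. (\<psi> t - \<psi> s) powr (- \<alpha>) *\<^sub>R g s)"
  shows "AE t in lebesgue_on {l..b}. (\<lambda>s. (\<psi> t - \<psi> s) powr (- \<alpha>) *\<^sub>R g s) absolutely_integrable_on {l..t}"
    and "(\<lambda>t. ((\<psi> b - \<psi> t) powr (\<alpha> - 1) * hderiv l \<psi> t) *\<^sub>R Q t) absolutely_integrable_on {l..b}"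
    and "integral {l..b} (\<lambda>t. ((\<psi> b - \<psi> t) powr (\<alpha> - 1) * hderiv l \<psi> t) *\<^sub>R Q t) =
         (Gamma \<alpha> * Gamma (1 - \<alpha>)) *\<^sub>R integral {l..b} g"
proof -
  let ?\<mu> = "lebesgue_on {l..b}"
  define C where "C = Gamma \<alpha> * Gamma (1 - \<alpha>)"
  have C: "C > 0" using assms by (simp add: C_def Gamma_real_pos)
  define w where "w t = (\<psi> b - \<psi> t) powr (\<alpha> - 1) * hderiv l \<psi> t" for t
  define H where "H t s = (w t * (\<psi> t - \<psi> s) powr (- \<alpha>)) *\<^sub>R g s" for t s
  note [measurable] = psi_measurable_lebesgue_on[OF order.refl, of b]
  have [measurable]: "g \<in> borel_measurable ?\<mu>"
    using g by (simp add: absolutely_integrable_iff_integrable_lebesgue_on)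
  have meas: "(\<lambda>(s, t). H t s) \<in> borel_measurable (?\<mu> \<Otimes>\<^sub>M ?\<mu>)"
    unfolding H_def w_def by measurable
  have kern: "(\<lambda>t. w t * (\<psi> t - \<psi> s) powr (- \<alpha>)) absolutely_integrable_on {s..b}"
    "s < b \<Longrightarrow> integral {s..b} (\<lambda>t. w t * (\<psi> t - \<psi> s) powr (- \<alpha>)) = C" if "s \<in> {l..b}" for s
  proof -
    show "s < b \<Longrightarrow> integral {s..b} (\<lambda>t. w t * (\<psi> t - \<psi> s) powr (- \<alpha>)) = C"
      unfolding w_def C_def by (rule beta_kernel_has_integral(2)) (use that assms in auto)
    show "(\<lambda>t. w t * (\<psi> t - \<psi> s) powr (- \<alpha>)) absolutely_integrable_on {s..b}"
    proof (cases "s < b")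
      case True
      then show ?thesis
        unfolding w_def by (intro beta_kernel_has_integral(1)) (use that assms in auto)
    next
      case False
      then have "s = b" using that by simp
      then show ?thesis using absolutely_integrable_negligible[of "{b}"] by simp
    qed
  qed
  have sec: "(\<lambda>t. H t s) absolutely_integrable_on {s..b}" if "s \<in> {l..b}" for s
    using absolutely_integrable_linear[OF kern(1)[OF that] bounded_linear_scaleR_left[of "g s"]]
    by (simp add: o_def H_def)
  have w_nonneg: "0 \<le> w t" if "l \<le> t" for t
    using weight_nonneg that by (simp add: w_def)
  have bound: "integral {s..b} (\<lambda>t. norm (H t s)) \<le> C * norm (g s)" if s: "s \<in> {l..b}" for s
  proof (cases "s < b")
    case True
    have "integral {s..b} (\<lambda>t. norm (H t s)) = integral {s..b} (\<lambda>t. w t * (\<psi> t - \<psi> s) powr (- \<alpha>) * norm (g s))"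
      using w_nonneg s by (intro integral_cong) (auto simp: H_def abs_mult)
    then show ?thesis using kern(2)[OF s True] by simp
  next
    case False
    then show ?thesis using s C by simp
  qed
  have B: "(\<lambda>s. C * norm (g s)) absolutely_integrable_on {l..b}"
    using absolutely_integrable_norm[OF g] by (simp add: o_def)
  have F: "AE t in ?\<mu>. H t absolutely_integrable_on {l..t}"
    "(\<lambda>t. integral {l..t} (H t)) absolutely_integrable_on {l..b}"
    "integral {l..b} (\<lambda>t. integral {l..t} (H t)) =
     integral {l..b} (\<lambda>s. integral {s..b} (\<lambda>t. H t s))"
    by (rule Fubini_triangle[OF meas sec bound B]; assumption)+
  \<comment> \<open>at \<open>t = b\<close> the outer weight vanishes, so integrability of \<open>H t\<close> says nothing about the kernel there\<close>
  have "negligible {b}" by simp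
  then have "AE t in ?\<mu>. t \<noteq> b"
    by (simp add: AE_lebesgue_on_iff_negligible) (auto intro: negligible_subset)
  with F(1) AE_space[of ?\<mu>]
  show "AE t in lebesgue_on {l..b}. (\<lambda>s. (\<psi> t - \<psi> s) powr (- \<alpha>) *\<^sub>R g s) absolutely_integrable_on {l..t}"
  proof eventually_elim
    case (elim t)
    then have "w t > 0" using deriv_pos[of t] psi_less[of t b] by (simp add: w_def)
    then show ?case
      using absolutely_integrable_scaleR_left[OF elim(1), of "1 / w t"]
      by (simp add: H_def[abs_def])
  qed
  have inner: "integral {l..t} (H t) = w t *\<^sub>R Q t" for t
    unfolding Q_def H_def[abs_def] by (simp flip: scaleR_scaleR)
  show "(\<lambda>t. ((\<psi> b - \<psi> t) powr (\<alpha> - 1) * hderiv l \<psi> t) *\<^sub>R Q t) absolutely_integrable_on {l..b}"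
    using F(2) by (simp add: inner w_def)
  have "integral {l..b} (\<lambda>t. w t *\<^sub>R Q t) = integral {l..b} (\<lambda>s. integral {s..b} (\<lambda>t. H t s))"
    using F(3) by (simp add: inner)
  also have "\<dots> = integral {l..b} (\<lambda>s. C *\<^sub>R g s)"
  proof (rule integral_spike[of "{b}"])
    fix s assume "s \<in> {l..b} - {b}"
    then have s: "s \<in> {l..b}" "s < b" by auto
    have "integral {s..b} (\<lambda>t. H t s) = integral {s..b} (\<lambda>t. w t * (\<psi> t - \<psi> s) powr (- \<alpha>)) *\<^sub>R g s"
      using integral_linear[OF set_lebesgue_integral_eq_integral(1)[OF kern(1)[OF s(1)]] bounded_linear_scaleR_left[of "g s"]]
      by (simp add: o_def H_def)
    then show "C *\<^sub>R g s = integral {s..b} (\<lambda>t. H t s)" using kern(2)[OF s] by simp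
  qed simp
  finally show "integral {l..b} (\<lambda>t. ((\<psi> b - \<psi> t) powr (\<alpha> - 1) * hderiv l \<psi> t) *\<^sub>R Q t) =
         (Gamma \<alpha> * Gamma (1 - \<alpha>)) *\<^sub>R integral {l..b} g"
    by (simp add: w_def C_def)
qed

end

section \<open>Lyapunov estimate for Caputo equations\<close>

context psi_clock
begin

lemma psi_caputo_eq:
  fixes z :: "real \<Rightarrow> 'a::euclidean_space"
  assumes "\<alpha> < 1" "l \<le> t"
  shows "psi_caputo l \<psi> \<alpha> z t =
    (1 / Gamma (1 - \<alpha>)) *\<^sub>R integral {l..t} (\<lambda>s. (\<psi> t - \<psi> s) powr (- \<alpha>) *\<^sub>R hderiv l z s)"
proof -
  have "integral {l..t} (psi_RL_integrand l \<psi> (1 - \<alpha>) (J_psi l \<psi> z) t) =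
      integral {l..t} (\<lambda>s. (\<psi> t - \<psi> s) powr (- \<alpha>) *\<^sub>R hderiv l z s)"
  proof (intro integral_cong)
    fix s assume "s \<in> {l..t}"
    then have "0 < hderiv l \<psi> s" using deriv_pos by simp
    then show "psi_RL_integrand l \<psi> (1 - \<alpha>) (J_psi l \<psi> z) t s = (\<psi> t - \<psi> s) powr (- \<alpha>) *\<^sub>R hderiv l z s"
      by (simp add: psi_RL_integrand_def J_psi_def)
  qed
  then show ?thesis using assms by (simp add: psi_caputo_def psi_RL_integral_def)
qed

text \<open>The convexity inequality \<open>D\<^sup>\<alpha> |z - p|\<^sup>2 / 2 \<le> (z - p) \<bullet> D\<^sup>\<alpha> z\<close>, at every \<open>t\<close> at which the Caputo integrand is
  absolutely integrable. Up to a Gamma factor the difference of the two sides is the integral of the increasing kernel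
  \<open>(\<psi> t - \<psi> s)\<^sup>-\<^sup>\<alpha>\<close> against \<open>(z t - z s) \<bullet> z' s\<close>, whose tails are \<open>|z t - z r|\<^sup>2 / 2 \<ge> 0\<close>.\<close>

lemma caputo_square_inequality:
  fixes z :: "real \<Rightarrow> 'a::euclidean_space"
  assumes \<alpha>: "0 < \<alpha>" "\<alpha> < 1" and "l \<le> t"
    and cont: "continuous_on {l..} z" and AC: "locally_AC l z"
    and K: "(\<lambda>s. (\<psi> t - \<psi> s) powr (- \<alpha>) *\<^sub>R hderiv l z s) absolutely_integrable_on {l..t}"
  shows "integral {l..t} (\<lambda>s. (\<psi> t - \<psi> s) powr (- \<alpha>) * ((z s - p) \<bullet> hderiv l z s))
    \<le> Gamma (1 - \<alpha>) * ((z t - p) \<bullet> psi_caputo l \<psi> \<alpha> z t)"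
proof -
  let ?k = "\<lambda>s. (\<psi> t - \<psi> s) powr (- \<alpha>)" and ?g = "hderiv l z"
  have cz: "continuous_on {l..t} z" using cont by (rule continuous_on_subset) auto
  have i: "(\<lambda>s. ?k s * (u s \<bullet> ?g s)) absolutely_integrable_on {l..t}" if "continuous_on {l..t} u" for u
    using absolutely_integrable_inner_continuous[OF that K] by simp
  have i1: "(\<lambda>s. ?k s * ((z s - p) \<bullet> ?g s)) absolutely_integrable_on {l..t}"
    by (intro i continuous_intros cz)
  have i2: "(\<lambda>s. ?k s * ((z t - z s) \<bullet> ?g s)) absolutely_integrable_on {l..t}"
    by (intro i continuous_intros cz)
  have "0 \<le> integral {l..t} (\<lambda>s. ?k s * ((z t - z s) \<bullet> ?g s))"
  proof (rule integral_monotone_kernel_nonneg[OF \<open>l \<le> t\<close> _ _ _ i2])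
    fix x y assume xy: "l \<le> x" "x \<le> y" "y < t"
    then show "?k x \<le> ?k y"
      using psi_less[of y t] psi_le[of x y] \<alpha> by (intro powr_mono2') auto
  next
    show "(\<lambda>s. (z t - z s) \<bullet> ?g s) integrable_on {l..t}"
      using increment_inner_derivative(1)[OF AC order.refl \<open>l \<le> t\<close>] by (simp add: absolutely_integrable_on_def)
  next
    fix r assume "r \<in> {l..t}"
    then show "0 \<le> integral {r..t} (\<lambda>s. (z t - z s) \<bullet> ?g s)"
      by (subst increment_inner_derivative(2)[OF AC]) auto
  qed simp
  then have "integral {l..t} (\<lambda>s. ?k s * ((z s - p) \<bullet> ?g s)) \<le>
      integral {l..t} (\<lambda>s. ?k s * ((z s - p) \<bullet> ?g s)) + integral {l..t} (\<lambda>s. ?k s * ((z t - z s) \<bullet> ?g s))"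
    by simp
  also have "\<dots> = integral {l..t} (\<lambda>s. ?k s * ((z s - p) \<bullet> ?g s) + ?k s * ((z t - z s) \<bullet> ?g s))"
    using i1 i2 by (intro integral_add[symmetric]) (auto simp: absolutely_integrable_on_def)
  also have "\<dots> = integral {l..t} (\<lambda>s. (z t - p) \<bullet> (?k s *\<^sub>R ?g s))"
    by (intro integral_cong) (simp add: inner_diff_left algebra_simps)
  also have "\<dots> = (z t - p) \<bullet> integral {l..t} (\<lambda>s. ?k s *\<^sub>R ?g s)"
    using integral_linear[OF set_lebesgue_integral_eq_integral(1)[OF K] bounded_linear_inner_right[of "z t - p"]]
    by (simp add: o_def)
  also have "integral {l..t} (\<lambda>s. ?k s *\<^sub>R ?g s) = Gamma (1 - \<alpha>) *\<^sub>R psi_caputo l \<psi> \<alpha> z t"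
  proof -
    have "Gamma (1 - \<alpha>) \<noteq> 0" using \<alpha> by (metis Gamma_real_pos diff_gt_0_iff_gt less_irrefl)
    then show ?thesis using \<alpha> \<open>l \<le> t\<close> by (simp add: psi_caputo_eq)
  qed
  finally show ?thesis by simp
qed

lemma psi_RL_integral_real:
  fixes \<phi> :: "real \<Rightarrow> real"
  assumes "0 < \<alpha>"
  shows "Gamma \<alpha> * psi_RL_integral l \<psi> \<alpha> \<phi> t =
    integral {l..t} (\<lambda>s. (\<psi> t - \<psi> s) powr (\<alpha> - 1) * hderiv l \<psi> s * \<phi> s)"
proof -
  have "Gamma \<alpha> \<noteq> 0" using Gamma_real_pos[OF assms] by simp
  then show ?thesis
    using assms by (simp add: psi_RL_integral_def psi_RL_integrand_def[abs_def])
qed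

text \<open>If \<open>D\<^sup>\<alpha> z = F z\<close> and \<open>F\<close> points towards \<open>p\<close> at rate \<open>\<phi>\<close>, then \<open>D\<^sup>\<alpha> |z - p|\<^sup>2 / 2 \<le> - \<phi>\<close> almost everywhere, and
  applying \<open>I\<^sup>\<alpha>\<close> integrates this inequality. An almost-everywhere inequality suffices because \<open>I\<^sup>\<alpha>\<close> has a
  nonnegative kernel.\<close>

lemma lyapunov_descent:
  fixes z :: "real \<Rightarrow> 'a::euclidean_space" and \<phi> :: "real \<Rightarrow> real"
  assumes \<alpha>: "0 < \<alpha>" "\<alpha> \<le> 1"
    and sol: "psi_caputo_solution l \<psi> \<alpha> F z0 z"
    and \<phi>: "continuous_on {l..} \<phi>"
    and dissip: "\<And>t. l < t \<Longrightarrow> (z t - p) \<bullet> F (z t) \<le> - \<phi> t"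
    and "l \<le> b"
  shows "(norm (z b - p))\<^sup>2 / 2 + psi_RL_integral l \<psi> \<alpha> \<phi> b \<le> (norm (z0 - p))\<^sup>2 / 2"
proof -
  have cont: "continuous_on {l..} z" and AC: "locally_AC l z" and [simp]: "z l = z0"
    and eqn: "\<And>t. l < t \<Longrightarrow> psi_caputo l \<psi> \<alpha> z t = F (z t)"
    using sol by (auto simp: psi_caputo_solution_def)
  let ?g = "hderiv l z"
  define v where "v s = (z s - p) \<bullet> ?g s" for s
  define w where "w s = (\<psi> b - \<psi> s) powr (\<alpha> - 1) * hderiv l \<psi> s" for s
  note V = square_distance_primitive[OF AC \<open>l \<le> b\<close>, of p, folded v_def]
  have w\<phi>: "(\<lambda>s. w s * \<phi> s) integrable_on {l..b}"
    using weight_mult_absolutely_integrable[OF \<open>l \<le> b\<close> \<alpha>(1) \<phi>]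
    by (simp add: w_def absolutely_integrable_on_def)
  have G\<alpha>: "Gamma \<alpha> > 0" using \<alpha> by (simp add: Gamma_real_pos)
  have "Gamma \<alpha> * integral {l..b} v \<le> - integral {l..b} (\<lambda>s. w s * \<phi> s)"
  proof (cases "\<alpha> = 1")
    case True
    \<comment> \<open>the equation is not imposed at \<open>l\<close>, and \<open>0 powr 0 = 0\<close> makes the weight vanish at \<open>b\<close>\<close>
    have "integral {l..b} v \<le> integral {l..b} (\<lambda>s. - (w s * \<phi> s))"
    proof (rule integral_le_off_negligible[where N = "{l, b}"])
      fix s assume "s \<in> {l..b} - {l, b}"
      then have s: "l < s" "s < b" by auto
      have pos: "0 < hderiv l \<psi> s" using deriv_pos s by simp
      have "psi_caputo l \<psi> \<alpha> z s = (1 / hderiv l \<psi> s) *\<^sub>R ?g s"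
        using True by (simp add: psi_caputo_def psi_RL_integral_def J_psi_def)
      then have "?g s = hderiv l \<psi> s *\<^sub>R F (z s)"
        using pos by (simp flip: eqn[OF s(1)])
      then have "v s = hderiv l \<psi> s * ((z s - p) \<bullet> F (z s))" by (simp add: v_def)
      also have "\<dots> \<le> hderiv l \<psi> s * (- \<phi> s)"
        using dissip[OF s(1)] pos by (intro mult_left_mono) auto
      also have "hderiv l \<psi> s = w s"
        using True psi_less[of s b] s by (simp add: w_def)
      finally show "v s \<le> - (w s * \<phi> s)" by simp
    qed (use V(1) w\<phi> in \<open>auto simp: absolutely_integrable_on_def intro: integrable_neg\<close>)
    then show ?thesis using True by simp
  next
    case False
    then have \<alpha>1: "\<alpha> < 1" using \<alpha> by simp
    then have G1: "Gamma (1 - \<alpha>) > 0" by (simp add: Gamma_real_pos)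
    define Q where "Q t = integral {l..t} (\<lambda>s. (\<psi> t - \<psi> s) powr (- \<alpha>) * v s)" for t
    note C = caputo_kernel_inverse[OF \<alpha>(1) \<alpha>1 V(1), simplified real_scaleR_def, folded Q_def w_def]
    have gi: "?g absolutely_integrable_on {l..b}" by (rule locally_AC_absolutely_integrable[OF AC]) simp
    define N where "N = {t \<in> {l..b}. \<not> (\<lambda>s. (\<psi> t - \<psi> s) powr (- \<alpha>) *\<^sub>R ?g s) absolutely_integrable_on {l..t}}"
    have N: "negligible (insert l N)"
      using caputo_kernel_inverse(1)[OF \<alpha>(1) \<alpha>1 gi] unfolding N_def
      by (simp add: AE_lebesgue_on_iff_negligible)
    have "integral {l..b} (\<lambda>t. w t * Q t) \<le> integral {l..b} (\<lambda>t. - (Gamma (1 - \<alpha>) * (w t * \<phi> t)))"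
    proof (rule integral_le_off_negligible[OF _ _ N])
      show "(\<lambda>t. w t * Q t) integrable_on {l..b}"
        using C(2) by (simp add: absolutely_integrable_on_def)
      show "(\<lambda>t. - (Gamma (1 - \<alpha>) * (w t * \<phi> t))) integrable_on {l..b}"
        by (intro integrable_neg integrable_on_mult_right w\<phi>)
      fix t assume "t \<in> {l..b} - insert l N"
      then have t: "l < t" and K: "(\<lambda>s. (\<psi> t - \<psi> s) powr (- \<alpha>) *\<^sub>R ?g s) absolutely_integrable_on {l..t}"
        by (auto simp: N_def)
      have "Q t \<le> Gamma (1 - \<alpha>) * ((z t - p) \<bullet> psi_caputo l \<psi> \<alpha> z t)"
        unfolding Q_def v_def using t by (intro caputo_square_inequality \<alpha> \<alpha>1 cont AC K) simp
      also have "\<dots> \<le> Gamma (1 - \<alpha>) * (- \<phi> t)"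
        using G1 dissip[OF t] eqn[OF t] by (intro mult_left_mono) auto
      finally have "w t * Q t \<le> w t * (Gamma (1 - \<alpha>) * (- \<phi> t))"
        using weight_nonneg t by (intro mult_left_mono) (auto simp: w_def)
      then show "w t * Q t \<le> - (Gamma (1 - \<alpha>) * (w t * \<phi> t))" by (simp add: mult_ac)
    qed
    also have "\<dots> = Gamma (1 - \<alpha>) * (- integral {l..b} (\<lambda>t. w t * \<phi> t))"
      by simp
    finally have "Gamma (1 - \<alpha>) * (Gamma \<alpha> * integral {l..b} v) \<le> Gamma (1 - \<alpha>) * (- integral {l..b} (\<lambda>s. w s * \<phi> s))"
      using C(3) by (simp add: mult_ac)
    then show ?thesis using G1 by (simp only: mult_le_cancel_left_pos)
  qed
  also have "integral {l..b} (\<lambda>s. w s * \<phi> s) = Gamma \<alpha> * psi_RL_integral l \<psi> \<alpha> \<phi> b"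
    using psi_RL_integral_real[OF \<alpha>(1)] by (simp add: w_def)
  finally have "Gamma \<alpha> * integral {l..b} v \<le> Gamma \<alpha> * (- psi_RL_integral l \<psi> \<alpha> \<phi> b)" by simp
  then have "integral {l..b} v \<le> - psi_RL_integral l \<psi> \<alpha> \<phi> b" 
    using G\<alpha> by (simp only: mult_le_cancel_left_pos)
  then show ?thesis using V(2) by simp
qed

end

section \<open>Convex functions and weighted means\<close>

lemma convex_gradient_inequality:
  fixes f :: "'a::euclidean_space \<Rightarrow> real"
  assumes conv: "convex_on UNIV f" and D: "GDERIV f x :> D"
  shows "f x + D \<bullet> (y - x) \<le> f y"
proof -
  define h where "h s = f (x + s *\<^sub>R (y - x))" for s :: real
  have "convex_on UNIV h"
  proof (rule convex_onI)
    fix t a b :: real assume t: "0 < t" "t < 1"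
    have "x + ((1 - t) *\<^sub>R a + t *\<^sub>R b) *\<^sub>R (y - x) =
        (1 - t) *\<^sub>R (x + a *\<^sub>R (y - x)) + t *\<^sub>R (x + b *\<^sub>R (y - x))"
      by (simp add: algebra_simps)
    then show "h ((1 - t) *\<^sub>R a + t *\<^sub>R b) \<le> (1 - t) * h a + t * h b"
      unfolding h_def using convex_onD[OF conv, of t] t by simp
  qed simp
  moreover have "(h has_field_derivative D \<bullet> (y - x)) (at 0)"
  proof -
    have "(f has_derivative (\<lambda>h. h \<bullet> D)) (at (x + 0 *\<^sub>R (y - x)))"
      using D by (simp add: gderiv_def)
    moreover have "((\<lambda>s. x + s *\<^sub>R (y - x)) has_derivative (\<lambda>s. s *\<^sub>R (y - x))) (at 0)"
      by (auto intro!: derivative_eq_intros)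
    ultimately have "(h has_derivative (\<lambda>s. (s *\<^sub>R (y - x)) \<bullet> D)) (at 0)"
      unfolding h_def by (rule has_derivative_compose[rotated])
    then show ?thesis
      by (simp add: has_field_derivative_def inner_commute mult_commute_abs)
  qed
  ultimately have "h 1 - h 0 \<ge> D \<bullet> (y - x) * (1 - 0)"
    by (intro convex_on_imp_above_tangent[of UNIV]) auto
  then show ?thesis by (simp add: h_def)
qed

lemma GDERIV_imp_continuous_on:
  assumes "\<And>x. GDERIV f x :> D x"
  shows "continuous_on S f"
  using assms unfolding gderiv_def
  by (meson continuous_at_imp_continuous_on has_derivative_continuous)

lemma GDERIV_zero_at_minimum:
  fixes f :: "'a::euclidean_space \<Rightarrow> real"
  assumes D: "GDERIV f x :> D" and min: "\<And>y. f x \<le> f y"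
  shows "D = 0"
proof -
  have "(\<lambda>h. h \<bullet> D) = (\<lambda>h. 0)"
    using D min by (intro has_derivative_local_min[of f]) (auto simp: gderiv_def)
  then have "D \<bullet> D = 0" by meson
  then show ?thesis by simp
qed

lemma min_value_eq:
  assumes "\<And>y. f p \<le> f y"
  shows "min_value f = f p"
  unfolding min_value_def using assms by (intro Least_equality) auto

context psi_clock
begin

lemma psi_mean_eq:
  fixes x :: "real \<Rightarrow> 'a::euclidean_space"
  assumes "0 < \<alpha>"
  shows "psi_mean l \<psi> \<alpha> x t = (\<alpha> / (\<psi> t - \<psi> l) powr \<alpha>) *\<^sub>R
    integral {l..t} (\<lambda>s. ((\<psi> t - \<psi> s) powr (\<alpha> - 1) * hderiv l \<psi> s) *\<^sub>R x s)"
proof -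
  have "Gamma \<alpha> \<noteq> 0" using Gamma_real_pos[OF assms] by simp
  moreover have "Gamma (\<alpha> + 1) = \<alpha> * Gamma \<alpha>"
    using assms by (intro Gamma_plus1) (auto elim!: nonpos_Ints_cases)
  ultimately show ?thesis
    using assms by (simp add: psi_mean_def psi_RL_integral_def psi_RL_integrand_def[abs_def])
qed

text \<open>The weights of \<open>psi_mean\<close> are nonnegative with total mass one, so affine minorants survive averaging.
  With \<open>v = 0\<close> it bounds the mean of \<open>\<phi>\<close> from below; with a tangent plane it gives Jensen's inequality.\<close>

lemma psi_mean_affine_le:
  fixes x :: "real \<Rightarrow> 'a::euclidean_space" and \<phi> :: "real \<Rightarrow> real"
  assumes "0 < \<alpha>" "l < t" and x: "continuous_on {l..} x" and \<phi>: "continuous_on {l..} \<phi>"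
    and le: "\<And>s. l \<le> s \<Longrightarrow> c + v \<bullet> x s \<le> \<phi> s"
  shows "c + v \<bullet> psi_mean l \<psi> \<alpha> x t \<le> psi_mean l \<psi> \<alpha> \<phi> t"
proof -
  define w where "w s = (\<psi> t - \<psi> s) powr (\<alpha> - 1) * hderiv l \<psi> s" for s
  define A where "A = (\<psi> t - \<psi> l) powr \<alpha> / \<alpha>"
  have A: "A > 0" using psi_less[of l t] assms by (simp add: A_def)
  have w: "(w has_integral A) {l..t}"
    using weight_has_integral[of t \<alpha>] assms by (simp add: w_def[abs_def] A_def)
  have wx: "(\<lambda>s. w s *\<^sub>R x s) integrable_on {l..t}" and w\<phi>: "(\<lambda>s. w s * \<phi> s) integrable_on {l..t}"
    using weight_mult_absolutely_integrable[of t \<alpha> x] weight_mult_absolutely_integrable[of t \<alpha> \<phi>] assms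
    by (simp_all add: w_def absolutely_integrable_on_def)
  have "((\<lambda>s. w s * c + v \<bullet> (w s *\<^sub>R x s)) has_integral
      A * c + v \<bullet> integral {l..t} (\<lambda>s. w s *\<^sub>R x s)) {l..t}"
    using has_integral_linear[OF integrable_integral[OF wx] bounded_linear_inner_right[of v]]
    by (intro has_integral_add has_integral_mult_left w) (simp add: o_def)
  moreover have "((\<lambda>s. w s * \<phi> s) has_integral integral {l..t} (\<lambda>s. w s * \<phi> s)) {l..t}"
    using w\<phi> by (rule integrable_integral)
  ultimately have "A * c + v \<bullet> integral {l..t} (\<lambda>s. w s *\<^sub>R x s) \<le> integral {l..t} (\<lambda>s. w s * \<phi> s)"
  proof (rule has_integral_le)
    fix s assume "s \<in> {l..t}"
    then have "w s * (c + v \<bullet> x s) \<le> w s * \<phi> s"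
      using weight_nonneg le by (intro mult_left_mono) (auto simp: w_def)
    then show "w s * c + v \<bullet> (w s *\<^sub>R x s) \<le> w s * \<phi> s" by (simp add: algebra_simps)
  qed
  moreover have "psi_mean l \<psi> \<alpha> x t = (1 / A) *\<^sub>R integral {l..t} (\<lambda>s. w s *\<^sub>R x s)"
    "psi_mean l \<psi> \<alpha> \<phi> t = (1 / A) * integral {l..t} (\<lambda>s. w s * \<phi> s)"
    using psi_mean_eq[OF assms(1), of x t] psi_mean_eq[OF assms(1), of \<phi> t]
    by (simp_all add: w_def A_def)
  ultimately show ?thesis using A by (simp add: field_simps)
qed

lemma psi_mean_jensen:
  fixes x :: "real \<Rightarrow> 'a::euclidean_space"
  assumes "0 < \<alpha>" "l < t" and x: "continuous_on {l..} x"
    and f: "convex_on UNIV f" and D: "\<And>x. GDERIV f x :> grad_f x"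
  shows "f (psi_mean l \<psi> \<alpha> x t) - c \<le> psi_mean l \<psi> \<alpha> (\<lambda>s. f (x s) - c) t"
proof -
  define m where "m = psi_mean l \<psi> \<alpha> x t"
  have "continuous_on UNIV f"
    using D by (rule GDERIV_imp_continuous_on)
  then have c: "continuous_on {l..} (\<lambda>s. f (x s) - c)"
    by (intro continuous_intros continuous_on_compose2[OF _ x]) auto
  have "(f m - c - grad_f m \<bullet> m) + grad_f m \<bullet> psi_mean l \<psi> \<alpha> x t
      \<le> psi_mean l \<psi> \<alpha> (\<lambda>s. f (x s) - c) t"
  proof (rule psi_mean_affine_le[OF assms(1,2) x c])
    fix s
    show "(f m - c - grad_f m \<bullet> m) + grad_f m \<bullet> x s \<le> f (x s) - c"
      using convex_gradient_inequality[OF f D, of m "x s"] by (simp add: inner_diff_right)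
  qed
  then show ?thesis by (simp add: m_def)
qed

end

section \<open>Convergence of the fractional gradient flow\<close>

theorem theorem5p1:
  fixes f :: "'a::euclidean_space \<Rightarrow> real"
    and grad_f :: "'a \<Rightarrow> 'a"
    and z :: "real \<Rightarrow> 'a"
    and z0 :: 'a
    and \<psi> :: "real \<Rightarrow> real"
    and \<alpha> \<beta> l :: real
  assumes "0 < \<alpha>" and "\<alpha> \<le> 1" and "0 \<le> l" and "0 < \<beta>"
    and "\<And>x. GDERIV f x :> grad_f x"
    and "continuous_on UNIV grad_f"
    and "convex_on UNIV f"
    and "{x. grad_f x = 0} \<noteq> {}"
    and "\<And>t. l \<le> t \<Longrightarrow> 0 \<le> \<psi> t"
    and "strict_mono_on {l..} \<psi>"
    and "C1_halfline l \<psi>"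
    and "\<And>t. l \<le> t \<Longrightarrow> 0 < hderiv l \<psi> t"
    and "\<not> bdd_above (\<psi> ` {l..})"
    and "psi_caputo_solution l \<psi> \<alpha> (\<lambda>x. - \<beta> *\<^sub>R grad_f x) z0 z"
  shows "bounded (z ` {l..}) \<and>
    (\<exists>s :: nat \<Rightarrow> real. (\<forall>m. s m \<in> {l..}) \<and>
       (\<exists>p\<in>{x. grad_f x = 0}. (\<lambda>m. z (s m)) \<longlonglongrightarrow> p)) \<and>
    ((\<lambda>t. f (psi_mean l \<psi> \<alpha> z t)) \<longlongrightarrow> min_value f) at_top \<and>
    (\<lambda>t. f (psi_mean l \<psi> \<alpha> z t) - min_value f) \<in> O[at_top](\<lambda>t. \<psi> t powr (- \<alpha>))"
proof -
  interpret psi_clock l \<psi>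
    using assms(10-12) by unfold_locales
  note D = assms(5) and conv = assms(7)
  obtain p where p: "grad_f p = 0" using assms(8) by auto
  have p_min: "f p \<le> f y" for y
    using convex_gradient_inequality[OF conv D, of p y] p by simp
  have mv: "min_value f = f p" using p_min by (rule min_value_eq)
  have contf: "continuous_on UNIV f"
    using D by (rule GDERIV_imp_continuous_on)
  have contz: "continuous_on {l..} z" and "z l = z0"
    using assms(14) by (auto simp: psi_caputo_solution_def)
  define \<phi> where "\<phi> t = f (z t) - f p" for t
  have \<phi>_nonneg: "0 \<le> \<phi> t" for t using p_min by (simp add: \<phi>_def)
  have cont\<phi>: "continuous_on {l..} \<phi>"
    unfolding \<phi>_def by (intro continuous_intros continuous_on_compose2[OF contf contz]) auto
  define E where "E = (norm (z0 - p))\<^sup>2 / 2"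
  have lyap: "(norm (z t - p))\<^sup>2 / 2 + \<beta> * psi_RL_integral l \<psi> \<alpha> \<phi> t \<le> E" if "l \<le> t" for t
  proof -
    have "(norm (z t - p))\<^sup>2 / 2 + psi_RL_integral l \<psi> \<alpha> (\<lambda>s. \<beta> * \<phi> s) t \<le> E"
      unfolding E_def
    proof (rule lyapunov_descent[OF assms(1,2,14) _ _ that])
      show "continuous_on {l..} (\<lambda>s. \<beta> * \<phi> s)" by (intro continuous_intros cont\<phi>)
      fix s
      have "\<phi> s \<le> (z s - p) \<bullet> grad_f (z s)"
        using convex_gradient_inequality[OF conv D, of "z s" p]
        by (simp add: \<phi>_def inner_diff_left inner_diff_right inner_commute)
      then show "(z s - p) \<bullet> (- \<beta> *\<^sub>R grad_f (z s)) \<le> - (\<beta> * \<phi> s)"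
        using \<open>0 < \<beta>\<close> by simp
    qed
    moreover have "psi_RL_integral l \<psi> \<alpha> (\<lambda>s. \<beta> * \<phi> s) t = \<beta> * psi_RL_integral l \<psi> \<alpha> \<phi> t"
    proof -
      have "Gamma \<alpha> * psi_RL_integral l \<psi> \<alpha> (\<lambda>s. \<beta> * \<phi> s) t = Gamma \<alpha> * (\<beta> * psi_RL_integral l \<psi> \<alpha> \<phi> t)"
        by (simp add: psi_RL_integral_real[OF \<open>0 < \<alpha>\<close>] mult.left_commute[of _ \<beta>])
      then show ?thesis using Gamma_real_pos[OF \<open>0 < \<alpha>\<close>] by simp
    qed
    ultimately show ?thesis by simp
  qed
  have RL_nonneg: "0 \<le> psi_RL_integral l \<psi> \<alpha> \<phi> t" if "l \<le> t" for t
  proof -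
    have "0 \<le> Gamma \<alpha> * psi_RL_integral l \<psi> \<alpha> \<phi> t"
      unfolding psi_RL_integral_real[OF \<open>0 < \<alpha>\<close>]
      using weight_mult_absolutely_integrable[OF that \<open>0 < \<alpha>\<close> cont\<phi>] weight_nonneg \<phi>_nonneg
      by (intro integral_nonneg) (auto simp: absolutely_integrable_on_def)
    then show ?thesis using Gamma_real_pos[OF \<open>0 < \<alpha>\<close>] by (simp add: zero_le_mult_iff)
  qed
  have ball: "z t \<in> cball p (sqrt (2 * E))" if "l \<le> t" for t
  proof -
    have "(norm (z t - p))\<^sup>2 \<le> 2 * E"
      using lyap[OF that] mult_nonneg_nonneg[of \<beta>, OF _ RL_nonneg[OF that]] \<open>0 < \<beta>\<close> by simp
    then show ?thesis by (simp add: real_le_rsqrt dist_norm norm_minus_commute)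
  qed
  define M where "M = Gamma (\<alpha> + 1) * E / \<beta>"
  have M: "M \<ge> 0" using assms by (simp add: M_def E_def Gamma_real_pos less_imp_le)
  have mean_bound: "psi_mean l \<psi> \<alpha> \<phi> t \<le> M * (\<psi> t - \<psi> l) powr (- \<alpha>)" if "l < t" for t
  proof -
    have "\<beta> * psi_RL_integral l \<psi> \<alpha> \<phi> t \<le> E"
      using lyap[of t] that zero_le_power2[of "norm (z t - p)"] by linarith
    then have "psi_RL_integral l \<psi> \<alpha> \<phi> t \<le> E / \<beta>" using \<open>0 < \<beta>\<close> by (simp add: field_simps)
    then have "Gamma (\<alpha> + 1) / (\<psi> t - \<psi> l) powr \<alpha> * psi_RL_integral l \<psi> \<alpha> \<phi> t
        \<le> Gamma (\<alpha> + 1) / (\<psi> t - \<psi> l) powr \<alpha> * (E / \<beta>)"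
      using \<open>0 < \<alpha>\<close> by (intro mult_left_mono) (auto simp: Gamma_real_pos less_imp_le)
    then show ?thesis by (simp add: psi_mean_def M_def powr_minus_divide mult.commute)
  qed
  have \<psi>_top: "filterlim \<psi> at_top at_top"
    unfolding filterlim_at_top
  proof
    fix C
    obtain u where u: "l \<le> u" "C < \<psi> u"
      using assms(13) by (auto simp: bdd_above_def not_le)
    show "\<forall>\<^sub>F t in at_top. C \<le> \<psi> t"
      using eventually_ge_at_top[of u] by eventually_elim (use u psi_le in fastforce)
  qed
  have powr_lim: "((\<lambda>t. \<psi> t powr (- \<alpha>)) \<longlongrightarrow> 0) at_top"
    using \<psi>_top \<open>0 < \<alpha>\<close> by (intro tendsto_neg_powr) auto
  \<comment> \<open>eventually \<open>\<psi> t \<ge> 2 \<psi> l\<close>, so \<open>\<psi> t - \<psi> l \<ge> \<psi> t / 2\<close>; this is the source of the factor \<open>1 / 2\<close>\<close>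
  define c where "c = M * (1 / 2) powr (- \<alpha>)"
  have bound: "\<forall>\<^sub>F t in at_top. l < t \<and> psi_mean l \<psi> \<alpha> \<phi> t \<le> c * \<psi> t powr (- \<alpha>)"
    using eventually_gt_at_top[of l] filterlim_at_top[THEN iffD1, OF \<psi>_top, rule_format, of "2 * \<psi> l + 1"]
  proof eventually_elim
    case (elim t)
    have "0 \<le> \<psi> l" using assms(9) by simp
    then have "(\<psi> t - \<psi> l) powr (- \<alpha>) \<le> (1 / 2 * \<psi> t) powr (- \<alpha>)"
      using elim \<open>0 < \<alpha>\<close> by (intro powr_mono2') auto
    also have "\<dots> = (1 / 2) powr (- \<alpha>) * \<psi> t powr (- \<alpha>)"
      by (rule powr_mult)
    finally have "M * (\<psi> t - \<psi> l) powr (- \<alpha>) \<le> c * \<psi> t powr (- \<alpha>)"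
      using mult_left_mono[OF _ M] by (simp add: c_def mult.assoc)
    then show ?case using mean_bound[OF elim(1)] elim(1) by simp
  qed
  have gap: "\<forall>\<^sub>F t in at_top. \<bar>f (psi_mean l \<psi> \<alpha> z t) - f p\<bar> \<le> c * \<psi> t powr (- \<alpha>)"
    using bound
  proof eventually_elim
    case (elim t)
    then show ?case
      using psi_mean_jensen[OF \<open>0 < \<alpha>\<close> _ contz conv D, of t "f p"] p_min[of "psi_mean l \<psi> \<alpha> z t"]
      by (simp add: \<phi>_def[abs_def])
  qed
  have bigo: "(\<lambda>t. f (psi_mean l \<psi> \<alpha> z t) - f p) \<in> O[at_top](\<lambda>t. \<psi> t powr (- \<alpha>))"
    using gap by (intro bigoI[of _ c]) simp
  have "((\<lambda>t. f (psi_mean l \<psi> \<alpha> z t) - f p) \<longlongrightarrow> 0) at_top"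
    by (rule Lim_null_comparison[of _ "\<lambda>t. c * \<psi> t powr (- \<alpha>)"])
      (use gap tendsto_mult_right_zero[OF powr_lim] in auto)
  then have lim: "((\<lambda>t. f (psi_mean l \<psi> \<alpha> z t)) \<longlongrightarrow> f p) at_top"
    by (rule Lim_null[THEN iffD2])
  \<comment> \<open>a positive lower bound for \<open>\<phi>\<close> would bound its mean from below, but the mean tends to zero\<close>
  have small: "\<exists>s\<ge>l. \<phi> s < e" if "0 < e" for e
  proof (rule ccontr)
    assume "\<not> (\<exists>s\<ge>l. \<phi> s < e)"
    then have ge: "e \<le> \<phi> s" if "l \<le> s" for s using that by (meson not_le)
    have "((\<lambda>t. c * \<psi> t powr (- \<alpha>)) \<longlongrightarrow> 0) at_top"
      using tendsto_mult_right_zero[OF powr_lim] .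
    then have "\<forall>\<^sub>F t in at_top. c * \<psi> t powr (- \<alpha>) < e"
      using \<open>0 < e\<close> by (rule order_tendstoD)
    with bound have "\<forall>\<^sub>F t in at_top :: real filter. False"
    proof eventually_elim
      case (elim t)
      then have "e \<le> psi_mean l \<psi> \<alpha> \<phi> t"
        using psi_mean_affine_le[OF \<open>0 < \<alpha>\<close> _ contz cont\<phi>, of t e 0] ge by simp
      then show False using elim by simp
    qed
    then show False by simp
  qed
  have "\<forall>n. \<exists>s\<ge>l. \<phi> s < 1 / real (Suc n)"
    using small by simp
  then obtain s where s: "\<And>n. l \<le> s n" "\<And>n. \<phi> (s n) < 1 / real (Suc n)"
    by metis
  have "\<forall>n. (z \<circ> s) n \<in> cball p (sqrt (2 * E))" using ball s(1) by simp
  then obtain q r where r: "strict_mono r" and q: "((z \<circ> s) \<circ> r) \<longlonglongrightarrow> q"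
    using compact_cball[of p "sqrt (2 * E)"] unfolding compact_def by blast
  have "(\<lambda>n. f (((z \<circ> s) \<circ> r) n)) \<longlonglongrightarrow> f q"
    using contf q by (rule continuous_on_tendsto_compose) auto
  moreover have "(\<lambda>n. f (((z \<circ> s) \<circ> r) n)) \<longlonglongrightarrow> f p"
  proof -
    have "(\<lambda>n. \<phi> (s n)) \<longlonglongrightarrow> 0"
      by (rule tendsto_sandwich[OF _ _ tendsto_const LIMSEQ_inverse_real_of_nat])
        (use \<phi>_nonneg less_imp_le[OF s(2)] in \<open>auto simp: inverse_eq_divide\<close>)
    then have "(\<lambda>n. \<phi> (s (r n))) \<longlonglongrightarrow> 0"
      using LIMSEQ_subseq_LIMSEQ[OF _ r] by (fastforce simp: o_def)
    then show ?thesis unfolding \<phi>_def o_def by (rule Lim_null[THEN iffD2])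
  qed
  ultimately have "f q = f p" by (rule LIMSEQ_unique)
  then have "grad_f q = 0"
    using p_min by (intro GDERIV_zero_at_minimum[OF D]) simp
  then have "\<exists>s :: nat \<Rightarrow> real. (\<forall>m. s m \<in> {l..}) \<and>
       (\<exists>p\<in>{x. grad_f x = 0}. (\<lambda>m. z (s m)) \<longlonglongrightarrow> p)"
    using q s(1) by (intro exI[of _ "s \<circ> r"]) (auto simp: o_def)
  moreover have "bounded (z ` {l..})"
    using ball by (intro bounded_subset[OF bounded_cball[of p "sqrt (2 * E)"]]) auto
  ultimately show ?thesis using lim bigo by (simp add: mv)
qed

end
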